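(* For every real number $a$, every positive integer $m$ and every integer $n\ge 0$, the value of the $n$-th Bernoulli polynomial at $-a/m$ satisfies $$B_n\left(\frac{-a}{m}\right)=\sum_{k=0}^{n}k!\,\widetilde{W}_{m,a}(n,k)\,\frac{(-1)^k}{m^{n-k}(k+1)}.$$
   Context: For a real number $a$, a positive integer $m$ and integers $n,k\ge 0$, the noncentral Whitney numbers of the second kind are given by $$\widetilde{W}_{m,a}(n,k)=\frac{1}{m^k k!}\sum_{j=0}^{k}\binom{k}{j}(-1)^{k-j}(mj-a)^n,$$ with the convention $0^0=1$. $B_n(t)$ denotes the $n$-th Bernoulli polynomial, defined by $\sum_{n=0}^{\infty}B_n(t)\frac{z^n}{n!}=\frac{z e^{tz}}{e^z-1}$. *)

theory Defs
  imports Complex_Main "HOL-Computational_Algebra.Formal_Power_Series"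
begin

definition whitney2 :: "nat \<Rightarrow> real \<Rightarrow> nat \<Rightarrow> nat \<Rightarrow> real" where
  "whitney2 m a n k =
     1 / (real m ^ k * fact k) *
     (\<Sum>j=0..k. real (k choose j) * (-1) ^ (k - j) * (real m * real j - a) ^ n)"

(* n! times the coefficient of z^n in z e^(tz) / (e^z - 1).  The divisor has constant term 0;
   bernoulli_poly_gf confirms that the quotient is exact. *)
definition bernoulli_poly :: "nat \<Rightarrow> real \<Rightarrow> real" where
  "bernoulli_poly n t = fact n * fps_nth (fps_X * fps_exp t / (fps_exp 1 - 1)) n"

lemma bernoulli_poly_gf:
  "Abs_fps (\<lambda>n. bernoulli_poly n t / fact n) * (fps_exp 1 - 1) = fps_X * fps_exp t"
proof -
  have 0: "fps_nth (fps_exp (1::real) - 1) 1 \<noteq> 0" by simp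
  hence nz: "fps_exp (1::real) - 1 \<noteq> 0" by (metis fps_zero_nth)
  have "subdegree (fps_exp (1::real) - 1) \<le> 1" by (rule subdegree_leI) (use 0 in simp)
  moreover have "1 \<le> subdegree (fps_X * fps_exp t)"
    by (rule subdegree_geI) (auto simp: fps_eq_iff intro!: exI[of _ 1])
  ultimately have "fps_exp (1::real) - 1 dvd fps_X * fps_exp t"
    using nz by (auto simp: fps_dvd_iff)
  moreover have "Abs_fps (\<lambda>n. bernoulli_poly n t / fact n) = fps_X * fps_exp t / (fps_exp 1 - 1)"
    by (simp add: fps_eq_iff bernoulli_poly_def)
  ultimately show ?thesis by simp
qed

end

theory Submission
  imports Defs
begin

text \<open>With $u = e^z - 1$ we have $z = \ln(1+u)$, so $z e^{tz}/(e^z-1) = e^{tz} \ln(1+u)/u =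
  \sum_k (-1)^k e^{tz} u^k/(k+1)$. By the binomial theorem, $n!$ times the coefficient of $z^n$ in
  $e^{tz} u^k$ is a $k$-th difference of $n$-th powers, which at $t = -a/m$ is a scaled
  noncentral Whitney number.\<close>

lemma fps_nth_exp_mult_exp_minus_1_power:
  fixes t :: "'a::field_char_0"
  shows "fact n * fps_nth (fps_exp t * (fps_exp 1 - 1) ^ k) n =
    (\<Sum>j=0..k. of_nat (k choose j) * (-1) ^ (k - j) * (of_nat j + t) ^ n)"
proof -
  have "(fps_exp 1 - 1 :: 'a fps) ^ k =
      (\<Sum>j\<le>k. of_nat (k choose j) * fps_exp 1 ^ j * (-1) ^ (k - j))"
    by (subst binomial_ring [symmetric]) simp
  then have "fps_exp t * (fps_exp 1 - 1) ^ k =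
      (\<Sum>j\<le>k. fps_const (of_nat (k choose j) * (-1) ^ (k - j)) * fps_exp (of_nat j + t))"
    by (simp add: sum_distrib_left fps_exp_power_mult fps_exp_add_mult fps_of_nat mult_ac
        flip: fps_const_mult fps_const_power fps_const_neg)
  then show ?thesis
    by (simp add: fps_sum_nth sum_distrib_left atMost_atLeast0)
qed

text \<open>As \<open>g\<close> has no constant term, \<open>g ^ k\<close> has no terms below degree
  \<open>k\<close>, so only \<open>k \<le> n\<close> contribute.\<close>

lemma fps_nth_mult_compose:
  fixes f g h :: "'a::comm_ring_1 fps"
  assumes "fps_nth g 0 = 0"
  shows "fps_nth (f * (h oo g)) n = (\<Sum>k=0..n. fps_nth h k * fps_nth (f * g ^ k) n)"
proof -
  \<comment> \<open>Padding with zeros up to \<open>n\<close> makes the bound independent of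
    \<open>i\<close>, so that the two sums can be swapped.\<close>
  have "fps_nth (h oo g) i = (\<Sum>k=0..n. fps_nth h k * fps_nth (g ^ k) i)" if "i \<le> n" for i
    unfolding fps_compose_nth using that assms
    by (intro sum.mono_neutral_left) (auto simp: startsby_zero_power_prefix)
  then have "fps_nth (f * (h oo g)) n =
      (\<Sum>i=0..n. fps_nth f i * (\<Sum>k=0..n. fps_nth h k * fps_nth (g ^ k) (n - i)))"
    by (simp add: fps_mult_nth)
  also have "\<dots> = (\<Sum>k=0..n. fps_nth h k * fps_nth (f * g ^ k) n)"
    unfolding fps_mult_nth sum_distrib_left
    by (subst sum.swap) (simp add: mult_ac)
  finally show ?thesis .
qed

text \<open>The composed series is ln(1+x)/x: this is z = ln(1+u) with one factor u split off, as
  needed to cancel the Bernoulli denominator.\<close>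

lemma fps_X_eq_ln_series_compose_exp:
  "(fps_X :: 'a::field_char_0 fps) =
    (Abs_fps (\<lambda>k. (-1) ^ k / of_nat (Suc k)) oo (fps_exp 1 - 1)) * (fps_exp 1 - 1)"
proof -
  let ?h = "Abs_fps (\<lambda>k. (-1) ^ k / of_nat (Suc k)) :: 'a fps"
  have "fps_ln 1 = ?h * fps_X"
    by (rule fps_ext) (auto simp: fps_ln_nth gr0_conv_Suc)
  moreover have "fps_ln 1 oo (fps_exp 1 - 1 :: 'a fps) = fps_X"
    using fps_inv[of "fps_exp 1 - 1 :: 'a fps"] by (simp add: fps_ln_fps_exp_inv)
  ultimately show ?thesis
    by (simp add: fps_compose_mult_distrib)
qed

lemma bernoulli_poly_eq_sum_differences:
  "bernoulli_poly n t =
    (\<Sum>k=0..n. (-1) ^ k / (real k + 1) *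
      (\<Sum>j=0..k. real (k choose j) * (-1) ^ (k - j) * (real j + t) ^ n))"
proof -
  let ?h = "Abs_fps (\<lambda>k. (-1) ^ k / real (Suc k))"
  let ?u = "fps_exp 1 - 1 :: real fps"
  \<comment> \<open>\<open>?u\<close> has constant term 0 and is not a unit, so the quotient is
    found by factoring \<open>?u\<close> out of the numerator and cancelling.\<close>
  have "fps_nth ?u 1 \<noteq> 0" by simp
  then have "?u \<noteq> 0" by (metis fps_zero_nth)
  moreover have "fps_X * fps_exp t = fps_exp t * (?h oo ?u) * ?u"
    by (subst fps_X_eq_ln_series_compose_exp) (simp add: mult_ac)
  ultimately have "fps_X * fps_exp t / ?u = fps_exp t * (?h oo ?u)"
    by (simp only: nonzero_mult_div_cancel_right not_False_eq_True)
  then have "bernoulli_poly n t =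
      (\<Sum>k=0..n. (-1) ^ k / (real k + 1) * (fact n * fps_nth (fps_exp t * ?u ^ k) n))"
    by (simp add: bernoulli_poly_def fps_nth_mult_compose sum_distrib_left mult_ac add_ac)
  then show ?thesis
    by (simp add: fps_nth_exp_mult_exp_minus_1_power)
qed

text \<open>Factoring m out of mj - a gives m^n, which the prefactor 1/m^k reduces to m^(n-k)
  because \<open>k \<le> n\<close>.\<close>

lemma fact_mult_whitney2:
  assumes "m > 0" "k \<le> n"
  shows "fact k * whitney2 m a n k = real m ^ (n - k) *
    (\<Sum>j=0..k. real (k choose j) * (-1) ^ (k - j) * (real j + - a / real m) ^ n)"
proof -
  have "(real m * real j - a) ^ n = real m ^ n * (real j + - a / real m) ^ n" for j
    using assms by (simp add: field_simps flip: power_mult_distrib)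
  then show ?thesis
    using assms by (simp add: whitney2_def power_diff sum_distrib_left mult_ac)
qed

theorem corollary3:
  fixes a :: real and m n :: nat
  assumes "m > 0"
  shows "bernoulli_poly n (- a / real m) =
    (\<Sum>k=0..n. fact k * whitney2 m a n k * ((-1) ^ k / (real m ^ (n - k) * (real k + 1))))"
  unfolding bernoulli_poly_eq_sum_differences
  \<comment> \<open>The sums agree term by term, since the two powers
    \<open>real m ^ (n - k)\<close> cancel.\<close>
  using assms by (intro sum.cong) (simp_all add: fact_mult_whitney2)

end
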